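(* Let $\boldsymbol{Z}=\{z_{i,j}\in\mathbb{F}^2: i,j\in\mathbb{N}\}$ be a node set, let $m,n\in\mathbb{N}$ and $b,c\in\mathbb{F}$. For $i,j\in\mathbb{N}$ let $\boldsymbol{L}^i\boldsymbol{D}^j\boldsymbol{Z}=\{w_{a,b'}=z_{a+i,b'+j}: a,b'\in\mathbb{N}\}$. Then $$\tilde g_{m,n}((x+b,y+c);\boldsymbol{Z})=\sum_{i=0}^m\sum_{j=0}^n\binom{m}{i}\binom{n}{j}\,\tilde g_{m-i,n-j}((b,c);\boldsymbol{L}^i\boldsymbol{D}^j\boldsymbol{Z})\,x^{(i)}y^{(j)},$$ where $\tilde g_{m-i,n-j}((b,c);\cdot)$ denotes evaluation at $(x,y)=(b,c)$.
   Context: $\mathbb{F}$ is a field of characteristic zero. For $p\in\mathbb{F}[x,y]$, $\Delta_x p(x,y)=p(x,y)-p(x-1,y)$ and $\Delta_y p(x,y)=p(x,y)-p(x,y-1)$. For $z\in\mathbb{F}^2$, $\varepsilon(z)$ denotes evaluation at $(x,y)=z$. Write $(i,j)\preceq(m,n)$ if $i\le m$ and $j\le n$. $\Pi^2_{m,n}$ is the space of polynomials of degree at most $m$ in $x$ and at most $n$ in $y$. For a node set $\boldsymbol{W}=\{w_{i,j}\}$ and $m,n\in\mathbb{N}$, $\tilde g_{m,n}((x,y);\boldsymbol{W})$ is the unique polynomial in $\Pi^2_{m,n}$ with $\varepsilon(w_{i,j})\Delta_x^i\Delta_y^j\tilde g_{m,n}((x,y);\boldsymbol{W})=m!\,n!\,\delta_{m,i}\delta_{n,j}$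 for all $(i,j)\preceq(m,n)$. The upper factorial is $t^{(0)}=1$, $t^{(k)}=t(t+1)\cdots(t+k-1)$. *)

theory Defs
  imports "HOL-Computational_Algebra.Polynomial"
begin

text \<open>
  A polynomial in \<open>x\<close> and \<open>y\<close> is rendered as an element of \<open>'a poly poly\<close>: the outer variable
  is \<open>x\<close> and the inner one is \<open>y\<close>, so \<open>coeff (coeff p i) j\<close> is the coefficient of \<open>x^i y^j\<close>.
\<close>

definition var_x :: "'a::comm_ring_1 poly poly" where
  "var_x = [:0, 1:]"

definition var_y :: "'a::comm_ring_1 poly poly" where
  "var_y = [:[:0, 1:]:]"

definition const2 :: "'a::comm_ring_1 \<Rightarrow> 'a poly poly" where
  "const2 a = [:[:a:]:]"

definition eval2 :: "'a::comm_ring_1 \<times> 'a \<Rightarrow> 'a poly poly \<Rightarrow> 'a" where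
  "eval2 z p = poly (poly p [:fst z:]) (snd z)"

text \<open>The polynomial \<open>p(x + b, y + c)\<close>.\<close>

definition translate2 :: "'a::comm_ring_1 \<Rightarrow> 'a \<Rightarrow> 'a poly poly \<Rightarrow> 'a poly poly" where
  "translate2 b c p = pcompose (map_poly (\<lambda>q. pcompose q [:c, 1:]) p) [:[:b:], 1:]"

lemma eval2_translate2: "eval2 (u, v) (translate2 b c p) = eval2 (u + b, v + c) p"
  by (induction p)
     (simp_all add: eval2_def translate2_def poly_pcompose map_poly_pCons algebra_simps)

definition delta_x :: "'a::comm_ring_1 poly poly \<Rightarrow> 'a poly poly" where
  "delta_x p = p - translate2 (- 1) 0 p"

definition delta_y :: "'a::comm_ring_1 poly poly \<Rightarrow> 'a poly poly" where
  "delta_y p = p - translate2 0 (- 1) p"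

definition Pi2 :: "nat \<Rightarrow> nat \<Rightarrow> 'a::comm_ring_1 poly poly set" where
  "Pi2 m n = {p. degree p \<le> m \<and> (\<forall>k. degree (coeff p k) \<le> n)}"

text \<open>
  A node set is an indexed family \<open>W i j\<close> of points of the plane; points may repeat.
  The conditions below are triangular with respect to the basis of products of rising
  factorials, so over a field of characteristic zero they determine exactly one polynomial.
\<close>

definition gonc :: "nat \<Rightarrow> nat \<Rightarrow> (nat \<Rightarrow> nat \<Rightarrow> 'a \<times> 'a) \<Rightarrow> 'a::field_char_0 poly poly" where
  "gonc m n W = (THE p. p \<in> Pi2 m n \<and>
     (\<forall>i\<le>m. \<forall>j\<le>n. eval2 (W i j) ((delta_x ^^ i) ((delta_y ^^ j) p)) =
        (if i = m \<and> j = n then fact m * fact n else 0)))"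

definition shift_nodes :: "nat \<Rightarrow> nat \<Rightarrow> (nat \<Rightarrow> nat \<Rightarrow> 'a \<times> 'a) \<Rightarrow> nat \<Rightarrow> nat \<Rightarrow> 'a \<times> 'a" where
  "shift_nodes i j Z = (\<lambda>k l. Z (k + i) (l + j))"

end

theory Submission
  imports Defs
begin

text \<open>
  Expand the translated polynomial in the basis \<open>pochhammer x i * pochhammer y j\<close>: by the
  discrete Taylor formula the coefficients are the mixed differences at \<open>(b, c)\<close>.
  Up to a constant factor the \<open>(i, j)\<close>-th mixed difference of \<open>gonc m n Z\<close> satisfies the
  conditions that determine \<open>gonc (m - i) (n - j) (shift_nodes i j Z)\<close>, hence is equal to it.
  The interpolant is unique because, by induction on \<open>m + n\<close>, the \<open>x\<close>- and \<open>y\<close>-differences of a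
  solution of the homogeneous problem vanish, so that it is a constant with a zero.
\<close>

subsection \<open>Evaluation of bivariate polynomials\<close>

lemma eval2_simps [simp]:
  "eval2 z 0 = 0" "eval2 z 1 = 1"
  "eval2 z (p + q) = eval2 z p + eval2 z q"
  "eval2 z (p - q) = eval2 z p - eval2 z q"
  "eval2 z (p * q) = eval2 z p * eval2 z q"
  "eval2 z (of_nat k) = of_nat k"
  "eval2 z (const2 a) = a" "eval2 z var_x = fst z" "eval2 z var_y = snd z"
  by (simp_all add: eval2_def const2_def var_x_def var_y_def of_nat_poly)

lemma eval2_of_int [simp]: "eval2 z (of_int k) = of_int k"
  by (simp add: eval2_def of_int_poly)

lemma eval2_pochhammer [simp]: "eval2 z (pochhammer p k) = pochhammer (eval2 z p) k"
  by (induction k) (simp_all add: pochhammer_Suc)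

lemma eval2_sum [simp]: "eval2 z (sum f A) = (\<Sum>i\<in>A. eval2 z (f i))"
  by (induction A rule: infinite_finite_induct) simp_all

text \<open>A field of characteristic zero is infinite. A polynomial in \<open>y\<close> vanishing
  everywhere is zero, so every constant \<open>[:u:]\<close> is a root of \<open>p - q\<close> over
  the domain of polynomials in \<open>y\<close>, which is too many roots. Identities of polynomials
  can thus be checked pointwise.\<close>

lemma eval2_eqI:
  fixes p q :: "'a::field_char_0 poly poly"
  assumes "\<And>u v. eval2 (u, v) p = eval2 (u, v) q"
  shows "p = q"
proof -
  have "poly (poly (p - q) [:u:]) v = 0" for u v
    using assms[of u v] by (simp add: eval2_def)
  then have "poly (p - q) [:u:] = 0" for u
    by (metis poly_all_0_iff_0)
  then have "range (\<lambda>u. [:u:]) \<subseteq> {x. poly (p - q) x = 0}"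
    by auto
  moreover have "infinite (range (\<lambda>u::'a. [:u:]))"
    using finite_imageD[of "\<lambda>u::'a. [:u:]" UNIV] by (auto simp: inj_def infinite_UNIV_char_0)
  ultimately have "p - q = 0"
    using poly_roots_finite finite_subset by blast
  then show ?thesis by simp
qed

lemma eval2_translate2' [simp]: "eval2 z (translate2 b c p) = eval2 (fst z + b, snd z + c) p"
  using eval2_translate2[of "fst z" "snd z"] by simp

lemma eval2_delta_x [simp]:
  "eval2 z (delta_x p) = eval2 z p - eval2 (fst z - 1, snd z) p"
  by (simp add: delta_x_def)

lemma eval2_delta_y [simp]:
  "eval2 z (delta_y p) = eval2 z p - eval2 (fst z, snd z - 1) p"
  by (simp add: delta_y_def)

lemma translate2_simps:
  fixes p q :: "'a::field_char_0 poly poly"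
  shows "translate2 b c 0 = (0 :: 'a poly poly)"
    and "translate2 b c (p + q) = translate2 b c p + translate2 b c q"
    and "translate2 b c (p * q) = translate2 b c p * translate2 b c q"
    and "translate2 b c (const2 a) = const2 a"
    and "translate2 b c (pochhammer p k) = pochhammer (translate2 b c p) k"
    and "translate2 b c var_x = var_x + const2 b"
    and "translate2 b c var_y = var_y + const2 c"
  by (rule eval2_eqI; simp)+

lemma const2_simps:
  "const2 (0::'a::field_char_0) = 0" "const2 (1::'a) = 1"
  "const2 (a * a') = (const2 a * const2 a' :: 'a poly poly)"
  "const2 (of_nat k :: 'a) = of_nat k"
  by (rule eval2_eqI; simp)+

subsection \<open>Mixed differences\<close>

definition mixed_delta :: "nat \<Rightarrow> nat \<Rightarrow> 'a::comm_ring_1 poly poly \<Rightarrow> 'a poly poly" where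
  "mixed_delta i j p = (delta_x ^^ i) ((delta_y ^^ j) p)"

text \<open>Commutation with a single difference passes to iterates; \<open>h\<close> is a scalar
  multiplication, a translation or a difference operator below.\<close>

lemma funpow_hom: "(\<And>x. f (h x) = h (g x)) \<Longrightarrow> (f ^^ k) (h x) = h ((g ^^ k) x)"
  by (induction k) simp_all

context
  fixes p q :: "'a::field_char_0 poly poly"
begin

lemma mixed_delta_add: "mixed_delta i j (p + q) = mixed_delta i j p + mixed_delta i j q"
proof -
  have dx: "(delta_x ^^ i) (r + s) = (delta_x ^^ i) r + (delta_x ^^ i) s"
    for i and r s :: "'a poly poly"
  proof (induction i)
    case (Suc i)
    then show ?case by simp (rule eval2_eqI; simp)
  qed simp
  have dy: "(delta_y ^^ j) (r + s) = (delta_y ^^ j) r + (delta_y ^^ j) s"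
    for j and r s :: "'a poly poly"
  proof (induction j)
    case (Suc j)
    then show ?case by simp (rule eval2_eqI; simp)
  qed simp
  show ?thesis
    by (simp add: mixed_delta_def dx dy)
qed

lemma mixed_delta_const2_mult: "mixed_delta i j (const2 a * p) = const2 a * mixed_delta i j p"
proof -
  have "delta_x (const2 a * r) = const2 a * delta_x r"
    and "delta_y (const2 a * r) = const2 a * delta_y r" for r :: "'a poly poly"
    by (rule eval2_eqI; simp add: algebra_simps)+
  then have "(delta_x ^^ i) (const2 a * r) = const2 a * (delta_x ^^ i) r"
    and "(delta_y ^^ j) (const2 a * r) = const2 a * (delta_y ^^ j) r" for r :: "'a poly poly"
    by (intro funpow_hom[of _ "\<lambda>p. const2 a * p"]; simp)+
  then show ?thesis
    by (simp add: mixed_delta_def)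
qed

lemma mixed_delta_translate2:
  "mixed_delta i j (translate2 b c p) = translate2 b c (mixed_delta i j p)"
proof -
  have "delta_x (translate2 b c r) = translate2 b c (delta_x r)"
    and "delta_y (translate2 b c r) = translate2 b c (delta_y r)" for r :: "'a poly poly"
    by (rule eval2_eqI; simp add: algebra_simps)+
  then show ?thesis
    by (simp add: mixed_delta_def funpow_hom[of _ "translate2 b c"])
qed

text \<open>\<open>delta_x\<close> and \<open>delta_y\<close> commute, so the inner
  \<open>x\<close>-differences can be moved past the outer \<open>y\<close>-differences. This lets
  later inductions peel off one difference at a time.\<close>

lemma mixed_delta_mixed_delta: "mixed_delta i j (mixed_delta k l p) = mixed_delta (i + k) (j + l) p"
proof -
  have "delta_y (delta_x r) = delta_x (delta_y r)" for r :: "'a poly poly"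
    by (rule eval2_eqI) (simp add: algebra_simps)
  then have "delta_y ((delta_x ^^ k) r) = (delta_x ^^ k) (delta_y r)" for r :: "'a poly poly"
    by (simp add: funpow_hom[of delta_x delta_y delta_x])
  then have "(delta_y ^^ j) ((delta_x ^^ k) r) = (delta_x ^^ k) ((delta_y ^^ j) r)"
    for r :: "'a poly poly"
    by (rule funpow_hom)
  then show ?thesis
    by (simp add: mixed_delta_def funpow_add)
qed

end

lemma mixed_delta_0 [simp]: "mixed_delta i j (0 :: 'a::field_char_0 poly poly) = 0"
  using mixed_delta_add[of i j 0 0] by simp

lemma mixed_delta_0_0 [simp]: "mixed_delta 0 0 p = p"
  by (simp add: mixed_delta_def)

lemma mixed_delta_diff:
  "mixed_delta i j (p - q) = mixed_delta i j p - mixed_delta i j (q :: 'a::field_char_0 poly poly)"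
  using mixed_delta_add[of i j "p - q" q] by (simp add: algebra_simps)

lemma mixed_delta_sum:
  "mixed_delta i j (sum f A) = (\<Sum>k\<in>A. mixed_delta i j (f k :: 'a::field_char_0 poly poly))"
  by (induction A rule: infinite_finite_induct) (simp_all add: mixed_delta_add)

subsection \<open>The basis of rising factorials\<close>

definition rising2 :: "nat \<Rightarrow> nat \<Rightarrow> 'a::comm_ring_1 poly poly" where
  "rising2 i j = pochhammer var_x i * pochhammer var_y j"

lemma eval2_rising2 [simp]:
  "eval2 z (rising2 i j) = pochhammer (fst z) i * pochhammer (snd z) j"
  by (simp add: rising2_def)

text \<open>Both terms contain the factor \<open>pochhammer u k\<close>, with cofactors
  \<open>u + k\<close> and \<open>u - 1\<close>. Rising factorials thus behave under backward
  differences as powers do under derivatives.\<close>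

lemma pochhammer_backward_difference:
  fixes u :: "'a::comm_ring_1"
  shows "pochhammer u (Suc k) - pochhammer (u - 1) (Suc k) = of_nat (Suc k) * pochhammer u k"
  using pochhammer_rec[of "u - 1" k] pochhammer_rec'[of u k] by (simp add: algebra_simps)

text \<open>For \<open>i = 0\<close> the truncated \<open>i - 1\<close> is harmless, because the
  scalar factor is zero.\<close>

lemma delta_x_rising2:
  "delta_x (rising2 i j :: 'a::field_char_0 poly poly) = const2 (of_nat i) * rising2 (i - 1) j"
proof (rule eval2_eqI)
  fix u v :: 'a
  show "eval2 (u, v) (delta_x (rising2 i j)) = eval2 (u, v) (const2 (of_nat i) * rising2 (i - 1) j)"
    using pochhammer_backward_difference[of u "i - 1"]
    by (cases i) (simp_all flip: left_diff_distrib)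
qed

lemma delta_y_rising2:
  "delta_y (rising2 i j :: 'a::field_char_0 poly poly) = const2 (of_nat j) * rising2 i (j - 1)"
proof (rule eval2_eqI)
  fix u v :: 'a
  show "eval2 (u, v) (delta_y (rising2 i j)) = eval2 (u, v) (const2 (of_nat j) * rising2 i (j - 1))"
    using pochhammer_backward_difference[of v "j - 1"]
    by (cases j) (simp_all flip: right_diff_distrib)
qed

text \<open>The binomial coefficient makes the right-hand side vanish when \<open>k > i\<close> or \<open>l > j\<close>.\<close>

lemma mixed_delta_rising2:
  "mixed_delta k l (rising2 i j :: 'a::field_char_0 poly poly) =
    const2 (of_nat (fact k * (i choose k) * (fact l * (j choose l)))) * rising2 (i - k) (j - l)"
proof -
  \<comment> \<open>\<open>fact k * (i choose k)\<close> is the falling factorial of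
    \<open>i\<close> with \<open>k\<close> factors; \<open>i - k\<close> is its next factor. Both
    sides are zero when \<open>k >= i\<close>.\<close>
  have step: "fact k * (i choose k) * (i - k) = fact (Suc k) * (i choose Suc k)" for i k :: nat
  proof -
    have "(i choose k) * (i - k) = Suc k * (i choose Suc k)"
      by (metis binomial_absorb_comp binomial_absorption mult.commute)
    then show ?thesis
      by (metis fact_Suc mult.assoc mult.commute of_nat_id)
  qed
  have y: "mixed_delta 0 l (rising2 i j :: 'a poly poly) =
      const2 (of_nat (fact l * (j choose l))) * rising2 i (j - l)" for l
  proof (induction l)
    case 0
    then show ?case by (simp add: const2_simps)
  next
    case (Suc l)
    have "mixed_delta 0 (Suc l) (rising2 i j :: 'a poly poly) =
        mixed_delta 0 1 (mixed_delta 0 l (rising2 i j))"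
      by (simp add: mixed_delta_mixed_delta)
    also have "\<dots> = const2 (of_nat (fact l * (j choose l))) * delta_y (rising2 i (j - l))"
      unfolding Suc mixed_delta_const2_mult by (simp add: mixed_delta_def)
    also have "\<dots> = const2 (of_nat (fact l * (j choose l) * (j - l))) * rising2 i (j - Suc l)"
      by (simp add: delta_y_rising2 const2_simps)
    finally show ?case unfolding step .
  qed
  show ?thesis
  proof (induction k)
    case 0
    then show ?case by (simp add: y)
  next
    case (Suc k)
    have "mixed_delta (Suc k) l (rising2 i j :: 'a poly poly) =
        mixed_delta 1 0 (mixed_delta k l (rising2 i j))"
      by (simp add: mixed_delta_mixed_delta)
    also have "\<dots> = const2 (of_nat (fact k * (i choose k) * (fact l * (j choose l)))) *
        delta_x (rising2 (i - k) (j - l))"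
      unfolding Suc mixed_delta_const2_mult by (simp add: mixed_delta_def)
    also have "\<dots> = const2 (of_nat (fact k * (i choose k) * (i - k) * (fact l * (j choose l)))) *
        rising2 (i - Suc k) (j - l)"
      by (simp add: delta_x_rising2 const2_simps ac_simps)
    finally show ?case unfolding step .
  qed
qed

text \<open>Multiply by \<open>x\<close> and use \<open>x * pochhammer x i = pochhammer x (Suc i) -
  i * pochhammer x i\<close>. The integer coefficients do not depend on \<open>x\<close>, and any
  commutative ring is allowed, so the formula also applies to the polynomials \<open>var_x\<close>
  and \<open>var_y\<close>.\<close>

lemma power_eq_sum_pochhammer:
  "\<exists>c::nat \<Rightarrow> int. \<forall>x::'a::comm_ring_1. x ^ k = (\<Sum>i\<le>k. of_int (c i) * pochhammer x i)"
proof (induction k)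
  case 0
  then show ?case by (auto intro: exI[of _ "\<lambda>_. 1"])
next
  case (Suc k)
  then obtain c :: "nat \<Rightarrow> int" where
    c: "\<And>x::'a. x ^ k = (\<Sum>i\<le>k. of_int (c i) * pochhammer x i)" by blast
  \<comment> \<open>The coefficients after multiplication by \<open>x\<close>: the old ones shifted
    up, minus \<open>i\<close> times the old ones. The guard is needed because \<open>c\<close> is
    unconstrained beyond \<open>k\<close>.\<close>
  define d where "d i = (if i = 0 then 0 else c (i - 1)) - (if i \<le> k then int i * c i else 0)" for i
  have "x ^ Suc k = (\<Sum>i\<le>Suc k. of_int (d i) * pochhammer x i)" for x :: 'a
  proof -
    have "x ^ Suc k = (\<Sum>i\<le>k. of_int (c i) * (pochhammer x (Suc i) - of_nat i * pochhammer x i))"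
      by (simp add: c sum_distrib_left pochhammer_Suc algebra_simps)
    also have "\<dots> = (\<Sum>i\<le>k. of_int (c i) * pochhammer x (Suc i)) -
        (\<Sum>i\<le>k. of_int (int i * c i) * pochhammer x i)"
      by (simp add: algebra_simps sum_subtractf)
    also have "(\<Sum>i\<le>k. of_int (c i) * pochhammer x (Suc i)) =
        (\<Sum>i\<le>Suc k. of_int (if i = 0 then 0 else c (i - 1)) * pochhammer x i)"
      by (subst sum.atMost_Suc_shift) simp
    also have "(\<Sum>i\<le>k. of_int (int i * c i) * pochhammer x i) =
        (\<Sum>i\<le>Suc k. of_int (if i \<le> k then int i * c i else 0) * pochhammer x i)"
      by simp
    finally show ?thesis
      by (simp add: d_def sum_subtractf algebra_simps del: sum.atMost_Suc)
  qed
  then show ?case by blast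
qed

section \<open>Closure properties of the spaces \<open>Pi2 m n\<close>\<close>

lemma Pi2_0 [simp]: "0 \<in> Pi2 m n"
  by (simp add: Pi2_def)

lemma Pi2_add: "p \<in> Pi2 m n \<Longrightarrow> q \<in> Pi2 m n \<Longrightarrow> p + q \<in> Pi2 m n"
  by (simp add: Pi2_def degree_add_le)

lemma Pi2_diff: "p \<in> Pi2 m n \<Longrightarrow> q \<in> Pi2 m n \<Longrightarrow> p - q \<in> Pi2 m n"
  by (simp add: Pi2_def degree_diff_le)

lemma Pi2_sum: "(\<And>i. i \<in> A \<Longrightarrow> f i \<in> Pi2 m n) \<Longrightarrow> sum f A \<in> Pi2 m n"
  by (induction A rule: infinite_finite_induct) (simp_all add: Pi2_add)

lemma Pi2_mono: "p \<in> Pi2 k l \<Longrightarrow> k \<le> m \<Longrightarrow> l \<le> n \<Longrightarrow> p \<in> Pi2 m n"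
  unfolding Pi2_def using le_trans by blast

lemma Pi2_mult:
  assumes "p \<in> Pi2 m n" "q \<in> Pi2 k l"
  shows "p * q \<in> Pi2 (m + k) (n + l)"
proof -
  have "degree (coeff p i * coeff q j) \<le> n + l" for i j
    using assms by (intro order_trans[OF degree_mult_le] add_mono) (simp_all add: Pi2_def)
  moreover have "degree (p * q) \<le> m + k"
    using assms by (intro order_trans[OF degree_mult_le] add_mono) (simp_all add: Pi2_def)
  ultimately show ?thesis
    by (simp add: Pi2_def coeff_mult degree_sum_le)
qed

lemma Pi2_const2_mult: "p \<in> Pi2 m n \<Longrightarrow> const2 a * p \<in> Pi2 m n"
  using Pi2_mult[of "const2 a" 0 0 p m n]
  by (simp add: Pi2_def const2_def coeff_pCons split: nat.splits)

text \<open>A general bidegree covers both uses below: \<open>var_x + const2 b\<close> has bidegree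
  at most (1, 0) and \<open>var_y + const2 c\<close> at most (0, 1).\<close>

lemma Pi2_pochhammer:
  assumes "p \<in> Pi2 m n"
  shows "pochhammer p k \<in> Pi2 (k * m) (k * n)"
proof (induction k)
  case 0
  then show ?case by (simp add: Pi2_def)
next
  case (Suc k)
  have "of_nat k \<in> Pi2 m n"
    by (simp add: Pi2_def of_nat_poly coeff_pCons split: nat.splits)
  then have "pochhammer p k * (p + of_nat k) \<in> Pi2 (k * m + m) (k * n + n)"
    by (intro Pi2_mult Suc Pi2_add assms)
  then show ?case by (simp add: pochhammer_Suc add.commute)
qed

lemma translate2_rising2_in_Pi2:
  "translate2 b c (rising2 i j :: 'a::field_char_0 poly poly) \<in> Pi2 i j"
proof -
  have "pochhammer (var_x + const2 b :: 'a poly poly) i \<in> Pi2 (i * 1) (i * 0)"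
    by (rule Pi2_pochhammer)
       (simp add: Pi2_def var_x_def const2_def coeff_pCons split: nat.splits)
  moreover have "pochhammer (var_y + const2 c :: 'a poly poly) j \<in> Pi2 (j * 0) (j * 1)"
    by (rule Pi2_pochhammer)
       (simp add: Pi2_def var_y_def const2_def coeff_pCons split: nat.splits)
  ultimately show ?thesis
    using Pi2_mult by (fastforce simp: rising2_def translate2_simps)
qed

lemma translate2_0_0 [simp]: "translate2 0 0 (p :: 'a::field_char_0 poly poly) = p"
  by (rule eval2_eqI) simp

lemma rising2_in_Pi2: "(rising2 i j :: 'a::field_char_0 poly poly) \<in> Pi2 i j"
  using translate2_rising2_in_Pi2[of 0 0 i j] by simp

section \<open>Rising factorials span \<open>Pi2 m n\<close>; the discrete Taylor formula\<close>

lemma poly_eq_sum_atMost: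
  fixes x :: "'a::comm_ring_1"
  shows "degree p \<le> n \<Longrightarrow> poly p x = (\<Sum>i\<le>n. coeff p i * x ^ i)"
  unfolding poly_altdef by (intro sum.mono_neutral_left) (auto simp: coeff_eq_0)

lemma Pi2_eq_sum_monomials:
  fixes p :: "'a::field_char_0 poly poly"
  assumes "p \<in> Pi2 m n"
  shows "p = (\<Sum>k\<le>m. \<Sum>l\<le>n. const2 (coeff (coeff p k) l) * (var_x ^ k * var_y ^ l))"
proof (rule eval2_eqI)
  fix u v :: 'a
  have pow: "eval2 z (q ^ k) = eval2 z q ^ k" for z :: "'a \<times> 'a" and q k
    by (induction k) simp_all
  have "poly p [:u:] = (\<Sum>k\<le>m. coeff p k * [:u:] ^ k)"
    using assms by (intro poly_eq_sum_atMost) (simp add: Pi2_def)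
  moreover have "poly (coeff p k) v = (\<Sum>l\<le>n. coeff (coeff p k) l * v ^ l)" for k
    using assms by (intro poly_eq_sum_atMost) (simp add: Pi2_def)
  ultimately have "eval2 (u, v) p = (\<Sum>k\<le>m. (\<Sum>l\<le>n. coeff (coeff p k) l * v ^ l) * u ^ k)"
    by (simp add: eval2_def poly_sum)
  then show "eval2 (u, v) p =
      eval2 (u, v) (\<Sum>k\<le>m. \<Sum>l\<le>n. const2 (coeff (coeff p k) l) * (var_x ^ k * var_y ^ l))"
    by (simp add: pow sum_distrib_left sum_distrib_right ac_simps)
qed

text \<open>Monomials are combinations of products of rising factorials of no larger bidegree.
  Linear statements on \<open>Pi2 m n\<close> therefore need checking only on scalar multiples of
  basis elements.\<close>

lemma Pi2_induct [consumes 1, case_names zero add rising]: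
  fixes p :: "'a::field_char_0 poly poly"
  assumes "p \<in> Pi2 m n"
    and "P 0"
    and add: "\<And>p q. P p \<Longrightarrow> P q \<Longrightarrow> P (p + q)"
    and rising: "\<And>a i j. i \<le> m \<Longrightarrow> j \<le> n \<Longrightarrow> P (const2 a * rising2 i j)"
  shows "P p"
proof -
  have sum: "P (sum f A)" if "\<And>i. i \<in> A \<Longrightarrow> P (f i)" for f :: "nat \<Rightarrow> 'a poly poly" and A
    using that by (induction A rule: infinite_finite_induct) (simp_all add: assms)
  have "P (const2 a * (var_x ^ k * var_y ^ l))" if "k \<le> m" "l \<le> n" for a k l
  proof -
    obtain c :: "nat \<Rightarrow> int" where
      c: "(var_x :: 'a poly poly) ^ k = (\<Sum>i\<le>k. of_int (c i) * pochhammer var_x i)"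
      using power_eq_sum_pochhammer by blast
    obtain d :: "nat \<Rightarrow> int" where
      d: "(var_y :: 'a poly poly) ^ l = (\<Sum>j\<le>l. of_int (d j) * pochhammer var_y j)"
      using power_eq_sum_pochhammer by blast
    have "const2 a * (var_x ^ k * var_y ^ l) =
        (\<Sum>i\<le>k. \<Sum>j\<le>l. const2 (a * of_int (c i) * of_int (d j)) * rising2 i j)"
      unfolding c d sum_product
      unfolding sum_distrib_left
      by (rule eval2_eqI) (simp add: ac_simps)
    also have "P \<dots>"
      using that by (intro sum rising) auto
    finally show ?thesis .
  qed
  then show ?thesis
    by (subst Pi2_eq_sum_monomials[OF assms(1)]) (intro sum, simp)
qed

lemma translate2_in_Pi2:
  fixes p :: "'a::field_char_0 poly poly"
  assumes "p \<in> Pi2 m n"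
  shows "translate2 b c p \<in> Pi2 m n"
  using assms
  by (induction rule: Pi2_induct)
     (auto simp: translate2_simps intro: Pi2_add Pi2_const2_mult Pi2_mono translate2_rising2_in_Pi2)

lemma mixed_delta_in_Pi2:
  fixes p :: "'a::field_char_0 poly poly"
  assumes "p \<in> Pi2 m n"
  shows "mixed_delta k l p \<in> Pi2 (m - k) (n - l)"
  using assms
proof (induction rule: Pi2_induct)
  case (rising a i j)
  then show ?case
    unfolding mixed_delta_const2_mult mixed_delta_rising2
    by (intro Pi2_const2_mult Pi2_mono[OF rising2_in_Pi2]) auto
qed (simp_all add: mixed_delta_add Pi2_add)

text \<open>On a basis element one of the two binomial coefficients is zero. This complements the
  preceding degree bound, where truncated subtraction hides the vanishing.\<close>

lemma mixed_delta_eq_0: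
  fixes p :: "'a::field_char_0 poly poly"
  assumes "p \<in> Pi2 m n" "m < k \<or> n < l"
  shows "mixed_delta k l p = 0"
  using assms(1)
proof (induction rule: Pi2_induct)
  case (rising a i j)
  then have "i < k \<or> j < l" using assms(2) by auto
  then have "fact k * (i choose k) * (fact l * (j choose l)) = (0::nat)"
    by (auto simp: binomial_eq_0)
  then show ?case
    unfolding mixed_delta_const2_mult mixed_delta_rising2
    by (simp only: const2_simps of_nat_0 mult_zero_left mult_zero_right)
qed (simp_all add: mixed_delta_add)

text \<open>The mixed differences at the origin, divided by the factorials, are the functionals dual
  to the basis \<open>rising2\<close>; by linearity it suffices to verify this duality.\<close>

lemma Pi2_taylor:
  fixes p :: "'a::field_char_0 poly poly"
  assumes "p \<in> Pi2 m n"
  shows "p = (\<Sum>k\<le>m. \<Sum>l\<le>n.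
    const2 (eval2 (0, 0) (mixed_delta k l p) / (fact k * fact l)) * rising2 k l)"
  using assms
proof (induction rule: Pi2_induct)
  case zero
  then show ?case by (simp add: const2_simps)
next
  case (add p q)
  have "p + q = (\<Sum>k\<le>m. \<Sum>l\<le>n.
      const2 (eval2 (0, 0) (mixed_delta k l p) / (fact k * fact l)) * rising2 k l) +
    (\<Sum>k\<le>m. \<Sum>l\<le>n.
      const2 (eval2 (0, 0) (mixed_delta k l q) / (fact k * fact l)) * rising2 k l)"
    using add by (rule arg_cong2)
  also have "\<dots> = (\<Sum>k\<le>m. \<Sum>l\<le>n.
    const2 (eval2 (0, 0) (mixed_delta k l (p + q)) / (fact k * fact l)) * rising2 k l)"
    by (rule eval2_eqI) (simp add: mixed_delta_add add_divide_distrib algebra_simps sum.distrib)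
  finally show ?case .
next
  case (rising a i j)
  have "eval2 (0, 0) (mixed_delta k l (const2 a * rising2 i j)) / (fact k * fact l) =
      (if k = i then if l = j then a else 0 else 0)" for k l
  proof -
    \<comment> \<open>In the first case a rising factorial of positive length survives and vanishes
      at the origin; in the second a binomial coefficient is zero.\<close>
    consider "k < i \<or> l < j" | "k > i \<or> l > j" | "k = i \<and> l = j" by linarith
    then show ?thesis
      by cases (auto simp: mixed_delta_const2_mult mixed_delta_rising2 pochhammer_0_left binomial_eq_0)
  qed
  then have "const2 (eval2 (0, 0) (mixed_delta k l (const2 a * rising2 i j)) / (fact k * fact l)) *
      rising2 k l = (if k = i then if l = j then const2 a * rising2 k l else 0 else 0)" for k l
    by (simp add: const2_simps)
  then have "(\<Sum>k\<le>m. \<Sum>l\<le>n. const2 (eval2 (0, 0) (mixed_delta k l (const2 a * rising2 i j)) /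
      (fact k * fact l)) * rising2 k l) =
    (\<Sum>k\<le>m. if k = i then \<Sum>l\<le>n. if l = j then const2 a * rising2 k l else 0 else 0)"
    by (intro sum.cong refl) simp
  also have "\<dots> = const2 a * rising2 i j"
    using rising by simp
  finally show ?case by simp
qed

subsection \<open>Existence and uniqueness of the interpolant\<close>

text \<open>The nodes must vary in the induction: an \<open>x\<close>-difference lowers
  \<open>m\<close> by one and replaces \<open>W i j\<close> by \<open>W (Suc i) j\<close>, and
  similarly for \<open>y\<close>.\<close>

lemma Pi2_interpolation_zero:
  fixes p :: "'a::field_char_0 poly poly"
  assumes "p \<in> Pi2 m n"
    and "\<And>i j. i \<le> m \<Longrightarrow> j \<le> n \<Longrightarrow> eval2 (W i j) (mixed_delta i j p) = 0"
  shows "p = 0"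
  using assms
proof (induction "m + n" arbitrary: m n p W rule: less_induct)
  case less
  \<comment> \<open>For \<open>m = 0\<close> there is no smaller instance to appeal to, but the
    difference vanishes by degree.\<close>
  have x: "mixed_delta 1 0 p = 0"
  proof (cases m)
    case 0
    with less.prems(1) show ?thesis by (simp add: mixed_delta_eq_0)
  next
    case (Suc m')
    show ?thesis
    proof (rule less.hyps)
      show "m' + n < m + n" using Suc by simp
      show "mixed_delta 1 0 p \<in> Pi2 m' n"
        using mixed_delta_in_Pi2[OF less.prems(1), of 1 0] Suc by simp
      show "eval2 (W (Suc i) j) (mixed_delta i j (mixed_delta 1 0 p)) = 0"
        if "i \<le> m'" "j \<le> n" for i j
        using less.prems(2)[of "Suc i" j] that Suc by (simp add: mixed_delta_mixed_delta)
    qed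
  qed
  have y: "mixed_delta 0 1 p = 0"
  proof (cases n)
    case 0
    with less.prems(1) show ?thesis by (simp add: mixed_delta_eq_0)
  next
    case (Suc n')
    show ?thesis
    proof (rule less.hyps)
      show "m + n' < m + n" using Suc by simp
      show "mixed_delta 0 1 p \<in> Pi2 m n'"
        using mixed_delta_in_Pi2[OF less.prems(1), of 0 1] Suc by simp
      show "eval2 (W i (Suc j)) (mixed_delta i j (mixed_delta 0 1 p)) = 0"
        if "i \<le> m" "j \<le> n'" for i j
        using less.prems(2)[of i "Suc j"] that Suc by (simp add: mixed_delta_mixed_delta)
    qed
  qed
  \<comment> \<open>Every other mixed difference factors through one of the two that vanish, so only
    the constant Taylor term remains.\<close>
  have "mixed_delta k l p = 0" if "(k, l) \<noteq> (0, 0)" for k l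
  proof (cases k)
    case 0
    then obtain l' where "l = Suc l'" using \<open>(k, l) \<noteq> (0, 0)\<close> by (cases l) auto
    then show ?thesis
      using mixed_delta_mixed_delta[of k l' 0 1 p] by (simp add: y[unfolded One_nat_def])
  next
    case (Suc k')
    then show ?thesis
      using mixed_delta_mixed_delta[of k' l 1 0 p] by (simp add: x[unfolded One_nat_def])
  qed
  then have "mixed_delta k l p = (if k = 0 then if l = 0 then p else 0 else 0)" for k l
    by auto
  then have "const2 (eval2 (0, 0) (mixed_delta k l p) / (fact k * fact l)) * rising2 k l =
      (if k = 0 then if l = 0 then const2 (eval2 (0, 0) p) else 0 else 0)" for k l
    by (simp add: rising2_def const2_simps)
  then have "p = (\<Sum>k\<le>m. \<Sum>l\<le>n. if k = 0 then if l = 0 then const2 (eval2 (0, 0) p) else 0 else 0)"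
    using Pi2_taylor[OF less.prems(1)] by simp
  also have "\<dots> = (\<Sum>k\<le>m. if k = 0 then \<Sum>l\<le>n. if l = 0 then const2 (eval2 (0, 0) p) else 0 else 0)"
    by (intro sum.cong) auto
  also have "\<dots> = const2 (eval2 (0, 0) p)"
    by simp
  finally have const: "p = const2 (eval2 (0, 0) p)" .
  \<comment> \<open>A constant has the same value at every point, so the condition at node
    \<open>W 0 0\<close> forces it to be zero.\<close>
  then have "eval2 (W 0 0) p = eval2 (0, 0) p"
    by (metis eval2_simps(7))
  then show ?case
    using const less.prems(2)[of 0 0] by (simp add: const2_simps)
qed

definition gonc_conditions ::
    "nat \<Rightarrow> nat \<Rightarrow> (nat \<Rightarrow> nat \<Rightarrow> 'a \<times> 'a) \<Rightarrow> 'a::field_char_0 poly poly \<Rightarrow> bool" where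
  "gonc_conditions m n W p \<longleftrightarrow> p \<in> Pi2 m n \<and>
     (\<forall>i\<le>m. \<forall>j\<le>n. eval2 (W i j) (mixed_delta i j p) =
        (if i = m \<and> j = n then fact m * fact n else 0))"

lemma gonc_conditions_unique:
  assumes "gonc_conditions m n W p" "gonc_conditions m n W q"
  shows "p = q"
proof -
  have "p - q = 0"
    by (rule Pi2_interpolation_zero[of _ m n W])
       (use assms in \<open>auto simp: gonc_conditions_def mixed_delta_diff intro: Pi2_diff\<close>)
  then show ?thesis by simp
qed

text \<open>
  Gram--Schmidt: subtract from the leading basis element the lower interpolants, each of which
  corrects exactly one of the conditions.
\<close>

lemma gonc_conditions_exist:
  fixes W :: "nat \<Rightarrow> nat \<Rightarrow> 'a::field_char_0 \<times> 'a"
  shows "\<exists>p. gonc_conditions m n W p"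
proof (induction "m + n" arbitrary: m n rule: less_induct)
  case less
  define I where "I = {..m} \<times> {..n} - {(m, n)}"
  have "\<exists>p. gonc_conditions (fst s) (snd s) W p" if "s \<in> I" for s
    using that by (intro less) (auto simp: I_def)
  then obtain G where G: "\<And>s. s \<in> I \<Longrightarrow> gonc_conditions (fst s) (snd s) W (G s)"
    by metis
  \<comment> \<open>The unwanted value of \<open>rising2 m n\<close> in condition \<open>s\<close>,
    divided by the value that \<open>G s\<close> takes there.\<close>
  define a where "a s = eval2 (W (fst s) (snd s)) (mixed_delta (fst s) (snd s) (rising2 m n)) /
    (fact (fst s) * fact (snd s))" for s
  define p where "p = rising2 m n - (\<Sum>s\<in>I. const2 (a s) * G s)"
  have G_Pi2: "G s \<in> Pi2 (fst s) (snd s)" if "s \<in> I" for s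
    using G[OF that] by (simp add: gonc_conditions_def)
  \<comment> \<open>Within the index range of \<open>s\<close> this is the defining condition of
    \<open>G s\<close>; outside it the difference vanishes by degree.\<close>
  have G_eval: "eval2 (W i j) (mixed_delta i j (G s)) =
      (if s = (i, j) then fact i * fact j else 0)" if "s \<in> I" for s i j
  proof (cases "i \<le> fst s \<and> j \<le> snd s")
    case True
    then show ?thesis
      using G[OF that] by (auto simp: gonc_conditions_def prod_eq_iff)
  next
    case False
    then show ?thesis
      using mixed_delta_eq_0[OF G_Pi2[OF that], of i j] by (auto simp: not_le)
  qed
  have "p \<in> Pi2 m n"
    unfolding p_def
    by (intro Pi2_diff Pi2_sum Pi2_const2_mult rising2_in_Pi2 Pi2_mono[OF G_Pi2]) (auto simp: I_def)
  moreover have "eval2 (W i j) (mixed_delta i j p) = (if i = m \<and> j = n then fact m * fact n else 0)"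
    if "i \<le> m" "j \<le> n" for i j
  proof -
    have "eval2 (W i j) (mixed_delta i j p) = eval2 (W i j) (mixed_delta i j (rising2 m n)) -
        (\<Sum>s\<in>I. a s * eval2 (W i j) (mixed_delta i j (G s)))"
      by (simp add: p_def mixed_delta_diff mixed_delta_sum mixed_delta_const2_mult)
    also have "(\<Sum>s\<in>I. a s * eval2 (W i j) (mixed_delta i j (G s))) =
        (\<Sum>s\<in>I. if s = (i, j) then a s * (fact i * fact j) else 0)"
      by (rule sum.cong) (auto simp: G_eval)
    also have "\<dots> = (if (i, j) \<in> I then a (i, j) * (fact i * fact j) else 0)"
      by (simp add: I_def)
    finally have *: "eval2 (W i j) (mixed_delta i j p) =
      eval2 (W i j) (mixed_delta i j (rising2 m n)) -
      (if (i, j) \<in> I then a (i, j) * (fact i * fact j) else 0)" .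
    show ?thesis
    \<comment> \<open>At the top index no correction is active and \<open>rising2 m n\<close>
      already gives \<open>fact m * fact n\<close>; elsewhere exactly one correction cancels the
      value.\<close>
    proof (cases "i = m \<and> j = n")
      case True
      then show ?thesis
        using * by (simp add: I_def mixed_delta_rising2)
    next
      case False
      then have "(i, j) \<in> I" using that by (auto simp: I_def)
      then show ?thesis
        using * False by (simp add: a_def)
    qed
  qed
  ultimately show ?case
    unfolding gonc_conditions_def by blast
qed

section \<open>Differences of \<open>gonc\<close> and the binomial expansion\<close>

lemma gonc_eqI:
  assumes "gonc_conditions m n W p"
  shows "gonc m n W = p"
proof -
  have "gonc m n W = (THE p. gonc_conditions m n W p)"
    by (simp add: gonc_def gonc_conditions_def mixed_delta_def)
  then show ?thesis
    using assms gonc_conditions_unique by (metis the_equality)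
qed

lemma gonc_conditions_gonc: "gonc_conditions m n W (gonc m n W)"
proof -
  obtain p where "gonc_conditions m n W p"
    using gonc_conditions_exist by blast
  then show ?thesis
    by (simp add: gonc_eqI)
qed

lemma mixed_delta_gonc:
  fixes Z :: "nat \<Rightarrow> nat \<Rightarrow> 'a::field_char_0 \<times> 'a"
  assumes "i \<le> m" "j \<le> n"
  shows "mixed_delta i j (gonc m n Z) =
    const2 (fact m * fact n / (fact (m - i) * fact (n - j))) *
    gonc (m - i) (n - j) (shift_nodes i j Z)"
proof -
  \<comment> \<open>Rescales the single nonzero value \<open>fact m * fact n\<close> to the one
    prescribed for the smaller interpolant.\<close>
  define a :: 'a where "a = fact (m - i) * fact (n - j) / (fact m * fact n)"
  have gonc: "gonc_conditions m n Z (gonc m n Z)"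
    by (rule gonc_conditions_gonc)
  have "gonc_conditions (m - i) (n - j) (shift_nodes i j Z) (const2 a * mixed_delta i j (gonc m n Z))"
    unfolding gonc_conditions_def
  proof (intro conjI allI impI)
    show "const2 a * mixed_delta i j (gonc m n Z) \<in> Pi2 (m - i) (n - j)"
      using gonc by (intro Pi2_const2_mult mixed_delta_in_Pi2) (simp add: gonc_conditions_def)
    fix k l assume "k \<le> m - i" "l \<le> n - j"
    then have "k + i \<le> m" "l + j \<le> n" "k + i = m \<longleftrightarrow> k = m - i" "l + j = n \<longleftrightarrow> l = n - j"
      using assms by auto
    then show "eval2 (shift_nodes i j Z k l)
        (mixed_delta k l (const2 a * mixed_delta i j (gonc m n Z))) =
      (if k = m - i \<and> l = n - j then fact (m - i) * fact (n - j) else 0)"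
      using gonc
      by (simp add: mixed_delta_const2_mult mixed_delta_mixed_delta shift_nodes_def
          gonc_conditions_def a_def)
  qed
  then have "gonc (m - i) (n - j) (shift_nodes i j Z) = const2 a * mixed_delta i j (gonc m n Z)"
    by (rule gonc_eqI)
  moreover have "const2 (fact m * fact n / (fact (m - i) * fact (n - j))) * const2 a =
      (1 :: 'a poly poly)"
    by (simp add: a_def flip: const2_simps)
  ultimately show ?thesis
    by (simp flip: mult.assoc)
qed

theorem theorem9:
  fixes Z :: "nat \<Rightarrow> nat \<Rightarrow> 'a::field_char_0 \<times> 'a"
    and m n :: nat
    and b c :: 'a
  shows "translate2 b c (gonc m n Z) =
    (\<Sum>i=0..m. \<Sum>j=0..n.
       of_nat (m choose i) * of_nat (n choose j)
       * const2 (eval2 (b, c) (gonc (m - i) (n - j) (shift_nodes i j Z)))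
       * pochhammer var_x i * pochhammer var_y j)"
proof -
  \<comment> \<open>Membership permits the Taylor formula at the origin; as differences commute with
    translation, its coefficients become differences of \<open>gonc m n Z\<close> at
    \<open>(b, c)\<close>.\<close>
  have "translate2 b c (gonc m n Z) \<in> Pi2 m n"
    using gonc_conditions_gonc by (intro translate2_in_Pi2) (auto simp: gonc_conditions_def)
  then have "translate2 b c (gonc m n Z) = (\<Sum>i\<le>m. \<Sum>j\<le>n.
      const2 (eval2 (b, c) (mixed_delta i j (gonc m n Z)) / (fact i * fact j)) * rising2 i j)"
    by (subst Pi2_taylor) (simp_all add: mixed_delta_translate2)
  also have "\<dots> = (\<Sum>i\<le>m. \<Sum>j\<le>n. of_nat (m choose i) * of_nat (n choose j)
       * const2 (eval2 (b, c) (gonc (m - i) (n - j) (shift_nodes i j Z)))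
       * pochhammer var_x i * pochhammer var_y j)"
  proof (intro sum.cong refl)
    fix i j assume "i \<in> {..m}" "j \<in> {..n}"
    then have "i \<le> m" "j \<le> n" by auto
    \<comment> \<open>The normalising factor of \<open>mixed_delta_gonc\<close> and the Taylor
      denominators combine to the two binomial coefficients.\<close>
    then have "eval2 (b, c) (mixed_delta i j (gonc m n Z)) / (fact i * fact j) =
      of_nat (m choose i) * of_nat (n choose j) *
      eval2 (b, c) (gonc (m - i) (n - j) (shift_nodes i j Z))"
      by (simp add: mixed_delta_gonc binomial_fact field_simps)
    then show "const2 (eval2 (b, c) (mixed_delta i j (gonc m n Z)) / (fact i * fact j)) *
        rising2 i j =
      of_nat (m choose i) * of_nat (n choose j)
       * const2 (eval2 (b, c) (gonc (m - i) (n - j) (shift_nodes i j Z)))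
       * pochhammer var_x i * pochhammer var_y j"
      by (simp add: const2_simps rising2_def mult.assoc)
  qed
  finally show ?thesis
    by (simp add: atMost_atLeast0)
qed

end
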